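(* $\mathbf{JID} \subseteq \mathbf{Dms}$; that is, every algebra in the variety $\mathbf{JID}$ satisfies the identity $(x \vee y)' \approx x' \wedge y'$.
   Context: A semi-Heyting algebra is an algebra $\langle L,\vee,\wedge,\to,0,1\rangle$ such that $\langle L,\vee,\wedge,0,1\rangle$ is a bounded lattice and the identities $x\wedge(x\to y)\approx x\wedge y$, $x\wedge(y\to z)\approx x\wedge[(x\wedge y)\to(x\wedge z)]$, $x\to x\approx 1$ hold. A $\mathbf{DQD}$-algebra (dually quasi-De Morgan semi-Heyting algebra) is an algebra $\langle L,\vee,\wedge,\to,{}',0,1\rangle$ whose reduct $\langle L,\vee,\wedge,\to,0,1\rangle$ is a semi-Heyting algebra and which satisfies: $0'\approx 1$ and $1'\approx 0$; $(x\wedge y)'\approx x'\vee y'$; $(x\vee y)''\approx x''\vee y''$; $x''\le x$. $\mathbf{DQD}$ denotes the variety of all $\mathbf{DQD}$-algebras. $\mathbf{JID}$ is the subvariety of $\mathbf{DQD}$ defined by the identity $x'\vee(y\to z)\approx(x'\vee y)\to(x'\vee z)$. $\mathbf{Dms}$ is the subvariety of $\mathbf{DQD}$ defined by the identity $(x\vee y)'\approx x'\wedge y'$. *)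

theory Defs
  imports Main
begin

text \<open>
  Algebras are rendered as locales over a type, extending the library locale \<open>bounded_lattice\<close>.
  That locale also carries the lattice order and its strict part as parameters; its axioms determine
  both from \<open>\<sqinter>\<close> and \<open>\<squnion>\<close>, so they are no additional structure. The bottom and top element are
  the constants 0 and 1 of the signature. A variety is rendered as a locale predicate, and inclusion
  of varieties as implication between locale predicates.
\<close>

locale semi_heyting_algebra =
  bounded_lattice inf less_eq less sup bot top
  for inf :: "'a \<Rightarrow> 'a \<Rightarrow> 'a" (infixl "\<sqinter>" 70)
    and less_eq :: "'a \<Rightarrow> 'a \<Rightarrow> bool" (infix "\<sqsubseteq>" 50)
    and less :: "'a \<Rightarrow> 'a \<Rightarrow> bool" (infix "\<sqsubset>" 50)
    and sup :: "'a \<Rightarrow> 'a \<Rightarrow> 'a" (infixl "\<squnion>" 65)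
    and bot :: 'a ("\<bottom>")
    and top :: 'a ("\<top>") +
  fixes imp :: "'a \<Rightarrow> 'a \<Rightarrow> 'a" (infixr "\<rightarrow>" 60)
  assumes inf_imp: "x \<sqinter> (x \<rightarrow> y) = x \<sqinter> y"
    and inf_imp_distrib: "x \<sqinter> (y \<rightarrow> z) = x \<sqinter> ((x \<sqinter> y) \<rightarrow> (x \<sqinter> z))"
    and imp_self: "x \<rightarrow> x = \<top>"

locale DQD = semi_heyting_algebra +
  fixes neg :: "'a \<Rightarrow> 'a" ("_\<^sup>\<prime>" [1000] 1000)
  assumes neg_bot: "\<bottom>\<^sup>\<prime> = \<top>"
    and neg_top: "\<top>\<^sup>\<prime> = \<bottom>"
    and neg_inf: "(x \<sqinter> y)\<^sup>\<prime> = x\<^sup>\<prime> \<squnion> y\<^sup>\<prime>"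
    and neg_neg_sup: "(x \<squnion> y)\<^sup>\<prime>\<^sup>\<prime> = x\<^sup>\<prime>\<^sup>\<prime> \<squnion> y\<^sup>\<prime>\<^sup>\<prime>"
    and neg_neg_le: "x\<^sup>\<prime>\<^sup>\<prime> \<sqsubseteq> x"

locale JID = DQD +
  assumes neg_sup_imp: "x\<^sup>\<prime> \<squnion> (y \<rightarrow> z) = (x\<^sup>\<prime> \<squnion> y) \<rightarrow> (x\<^sup>\<prime> \<squnion> z)"

locale Dms = DQD +
  assumes neg_sup: "(x \<squnion> y)\<^sup>\<prime> = x\<^sup>\<prime> \<sqinter> y\<^sup>\<prime>"

end

theory Submission
  imports Defs
begin

text \<open>
  Call \<open>a\<close> regular if \<open>a'' = a\<close>. Since \<open>x''' = x'\<close>, the regular elements are exactly the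
  elements \<open>x'\<close>, and they are closed under joins. In an algebra of \<open>JID\<close>, instantiating the
  identity with \<open>y = x'\<close>, \<open>z = \<bottom>\<close> yields \<open>a \<squnion> (a \<rightarrow> \<bottom>) = a \<rightarrow> a = \<top>\<close> for every regular \<open>a\<close>,
  so \<open>a \<rightarrow> \<bottom>\<close> is a complement of \<open>a\<close>. As \<open>''\<close> preserves joins and lies below the identity,
  distributivity makes every complement of a regular element regular
  (\<open>regular_complement\<close>). Hence a meet \<open>a \<sqinter> b\<close> of regular elements is regular, being a
  complement of the join of the complements of \<open>a\<close> and \<open>b\<close> (\<open>regular_inf\<close>). Finally
  \<open>(x \<squnion> y)'' = x'' \<squnion> y'' = (x' \<sqinter> y')'\<close>, and applying \<open>'\<close> once more gives
  \<open>(x \<squnion> y)' = (x' \<sqinter> y')'' = x' \<sqinter> y'\<close>.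
\<close>

context semi_heyting_algebra
begin

text \<open>
  In a semi-Heyting algebra \<open>\<rightarrow>\<close> itself need not be residuated with \<open>\<sqinter>\<close>, but
  \<open>x \<rightarrow> (x \<sqinter> y)\<close> is the relative pseudocomplement of \<open>x\<close> with respect to \<open>y\<close>.
  Its existence makes the lattice distributive, as in Heyting algebras.
\<close>

lemma le_imp_inf_iff: "z \<sqsubseteq> x \<rightarrow> (x \<sqinter> y) \<longleftrightarrow> x \<sqinter> z \<sqsubseteq> y"
proof
  assume "z \<sqsubseteq> x \<rightarrow> (x \<sqinter> y)"
  then have "x \<sqinter> z \<sqsubseteq> x \<sqinter> (x \<rightarrow> (x \<sqinter> y))"
    by (rule inf_mono[OF order_refl])
  also have "\<dots> = x \<sqinter> y"
    by (simp add: inf_imp)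
  finally show "x \<sqinter> z \<sqsubseteq> y"
    by simp
next
  assume "x \<sqinter> z \<sqsubseteq> y"
  then have "z \<sqinter> (x \<sqinter> y) = z \<sqinter> x"
    by (metis inf_absorb1 inf_assoc inf_commute)
  then have "z \<sqinter> (x \<rightarrow> (x \<sqinter> y)) = z \<sqinter> ((z \<sqinter> x) \<rightarrow> (z \<sqinter> x))"
    using inf_imp_distrib[of z x "x \<sqinter> y"] by simp
  then have "z \<sqinter> (x \<rightarrow> (x \<sqinter> y)) = z"
    by (simp add: imp_self)
  then show "z \<sqsubseteq> x \<rightarrow> (x \<sqinter> y)"
    by (simp add: le_iff_inf)
qed

lemma inf_sup_distrib: "x \<sqinter> (y \<squnion> z) = (x \<sqinter> y) \<squnion> (x \<sqinter> z)"
proof (rule order.antisym)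
  let ?w = "(x \<sqinter> y) \<squnion> (x \<sqinter> z)"
  have "y \<squnion> z \<sqsubseteq> x \<rightarrow> (x \<sqinter> ?w)"
    by (intro sup_least) (simp_all only: le_imp_inf_iff sup_ge1 sup_ge2)
  then show "x \<sqinter> (y \<squnion> z) \<sqsubseteq> ?w"
    by (simp only: le_imp_inf_iff)
qed (rule distrib_inf_le)

sublocale distrib_lattice inf less_eq less sup
  by unfold_locales (rule distrib_imp1[OF inf_sup_distrib])

end

context DQD
begin

lemma neg_antimono: "x \<sqsubseteq> y \<Longrightarrow> y\<^sup>\<prime> \<sqsubseteq> x\<^sup>\<prime>"
  by (metis inf_absorb1 neg_inf sup_ge2)

lemma neg_neg_neg: "x\<^sup>\<prime>\<^sup>\<prime>\<^sup>\<prime> = x\<^sup>\<prime>"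
  by (rule order.antisym[OF neg_neg_le neg_antimono[OF neg_neg_le]])

lemma regular_sup: "a\<^sup>\<prime>\<^sup>\<prime> = a \<Longrightarrow> b\<^sup>\<prime>\<^sup>\<prime> = b \<Longrightarrow> (a \<squnion> b)\<^sup>\<prime>\<^sup>\<prime> = a \<squnion> b"
  by (simp add: neg_neg_sup)

lemma regular_complement:
  assumes "e\<^sup>\<prime>\<^sup>\<prime> = e" and "c \<sqinter> e = \<bottom>" and "c \<squnion> e = \<top>"
  shows "c\<^sup>\<prime>\<^sup>\<prime> = c"
proof -
  have "c\<^sup>\<prime>\<^sup>\<prime> \<squnion> e = \<top>"
    using neg_neg_sup[of c e] assms by (simp add: neg_top neg_bot)
  then have "c = c \<sqinter> (c\<^sup>\<prime>\<^sup>\<prime> \<squnion> e)"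
    by simp
  also have "\<dots> = c \<sqinter> c\<^sup>\<prime>\<^sup>\<prime>"
    by (simp add: inf_sup_distrib assms)
  also have "\<dots> = c\<^sup>\<prime>\<^sup>\<prime>"
    by (rule inf_absorb2[OF neg_neg_le])
  finally show ?thesis
    by (rule sym)
qed

end

context JID
begin

lemma inf_imp_bot: "a \<sqinter> (a \<rightarrow> \<bottom>) = \<bottom>"
  by (simp add: inf_imp)

lemma regular_sup_imp_bot:
  assumes "a\<^sup>\<prime>\<^sup>\<prime> = a"
  shows "a \<squnion> (a \<rightarrow> \<bottom>) = \<top>"
  using neg_sup_imp[of "a\<^sup>\<prime>" a \<bottom>] assms by (simp add: imp_self)

lemma regular_imp_bot:
  assumes "a\<^sup>\<prime>\<^sup>\<prime> = a"
  shows "(a \<rightarrow> \<bottom>)\<^sup>\<prime>\<^sup>\<prime> = a \<rightarrow> \<bottom>"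
proof (rule regular_complement)
  show "(a \<rightarrow> \<bottom>) \<sqinter> a = \<bottom>"
    by (simp add: inf_commute[of _ a] inf_imp_bot)
  show "(a \<rightarrow> \<bottom>) \<squnion> a = \<top>"
    by (simp add: sup_commute[of _ a] regular_sup_imp_bot assms)
qed (rule assms)

lemma regular_inf:
  assumes a: "a\<^sup>\<prime>\<^sup>\<prime> = a" and b: "b\<^sup>\<prime>\<^sup>\<prime> = b"
  shows "(a \<sqinter> b)\<^sup>\<prime>\<^sup>\<prime> = a \<sqinter> b"
proof (rule regular_complement)
  let ?e = "(a \<rightarrow> \<bottom>) \<squnion> (b \<rightarrow> \<bottom>)"
  show "?e\<^sup>\<prime>\<^sup>\<prime> = ?e"
    by (intro regular_sup regular_imp_bot a b)
  have "a \<sqinter> b \<sqinter> (a \<rightarrow> \<bottom>) = \<bottom>" "a \<sqinter> b \<sqinter> (b \<rightarrow> \<bottom>) = \<bottom>"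
    by (simp_all add: inf_assoc inf_imp_bot inf_left_commute[of a])
  then show "a \<sqinter> b \<sqinter> ?e = \<bottom>"
    by (simp add: inf_sup_distrib)
  have "a \<squnion> ?e = \<top>" "b \<squnion> ?e = \<top>"
    by (metis regular_sup_imp_bot a b sup_assoc sup_commute sup_top_left)+
  then show "a \<sqinter> b \<squnion> ?e = \<top>"
    by (simp add: sup_inf_distrib2)
qed

lemma neg_sup: "(x \<squnion> y)\<^sup>\<prime> = x\<^sup>\<prime> \<sqinter> y\<^sup>\<prime>"
proof -
  have "(x \<squnion> y)\<^sup>\<prime> = (x \<squnion> y)\<^sup>\<prime>\<^sup>\<prime>\<^sup>\<prime>"
    by (simp only: neg_neg_neg)
  also have "\<dots> = (x\<^sup>\<prime> \<sqinter> y\<^sup>\<prime>)\<^sup>\<prime>\<^sup>\<prime>"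
    by (simp only: neg_neg_sup neg_inf)
  also have "\<dots> = x\<^sup>\<prime> \<sqinter> y\<^sup>\<prime>"
    by (intro regular_inf neg_neg_neg)
  finally show ?thesis .
qed

end

theorem theorem3p5:
  fixes inf sup imp :: "'a \<Rightarrow> 'a \<Rightarrow> 'a"
    and less_eq less :: "'a \<Rightarrow> 'a \<Rightarrow> bool"
    and bot top :: 'a
    and neg :: "'a \<Rightarrow> 'a"
  assumes "JID inf less_eq less sup bot top imp neg"
  shows "Dms inf less_eq less sup bot top imp neg"
proof -
  interpret JID inf less_eq less sup bot top imp neg
    by (rule assms)
  show ?thesis
    by unfold_locales (rule neg_sup)
qed

end
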